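(* If $G$ and $H$ are two quantum isomorphic graphs, then $G$ and $H$ have the same number of blocks and the same number of cut vertices.
   Context: All graphs are finite and simple. $\mathrm{Adj}(G)$ is the adjacency matrix. Quantum isomorphism: a magic unitary with coefficients in a (nonzero) unital $C^*$-algebra $X$ is a matrix $U=(u_{ij})_{i\in I,j\in J}$ with $I,J$ finite, $u_{ij}=u_{ij}^2=u_{ij}^*\in X$, and $\sum_{k\in I}u_{kj}=1=\sum_{k\in J}u_{ik}$ for all $i\in I,j\in J$. A quantum isomorphism from a graph $G$ to a graph $H$ with the same number of vertices is a magic unitary $U$ indexed by $V(H)\times V(G)$ with $U\,\mathrm{Adj}(G)=\mathrm{Adj}(H)\,U$. $G$ and $H$ are quantum isomorphic if such a $U$ exists over some nonzero unital $C^*$-algebra. Blocks: if $G$ has at least two vertices, a cut vertex of $G$ is a vertex $v$ such that $G\setminus\{v\}$ has strictly more connected components than $G$; for a graph on one vertex, its only vertex is by convention a cut vertex. A graph is 2-connected if it is connected and for every vertex $v$ the graph $G\setminus\{v\}$ is connected and nonempty (so $K_2$ is 2-connected and $K_1$ is not). A block of $G$ is a maximal 2-connected subgraph of $G$. *)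

theory Defs
  imports Complex_Main "Graph_Theory.Graph_Theory"
begin

text \<open>
  Nonzero unital complex \<open>C\<^sup>*\<close>-algebras: a unital Banach algebra with a complex scalar
  multiplication and an involution. The class \<open>real_normed_algebra_1\<close> contains \<open>0 \<noteq> 1\<close> and
  \<open>norm 1 = 1\<close>; the latter holds in every nonzero unital \<open>C\<^sup>*\<close>-algebra.
\<close>

class unital_cstar_algebra = banach + real_normed_algebra_1 +
  fixes cscale :: "complex \<Rightarrow> 'a \<Rightarrow> 'a"
    and cadj :: "'a \<Rightarrow> 'a"
  assumes cscale_add_right: "cscale c (x + y) = cscale c x + cscale c y"
    and cscale_add_left: "cscale (c + d) x = cscale c x + cscale d x"
    and cscale_cscale: "cscale c (cscale d x) = cscale (c * d) x"
    and cscale_of_real: "cscale (complex_of_real r) x = r *\<^sub>R x"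
    and norm_cscale: "norm (cscale c x) = cmod c * norm x"
    and mult_cscale_left: "cscale c x * y = cscale c (x * y)"
    and mult_cscale_right: "x * cscale c y = cscale c (x * y)"
    and cadj_add: "cadj (x + y) = cadj x + cadj y"
    and cadj_cscale: "cadj (cscale c x) = cscale (cnj c) (cadj x)"
    and cadj_mult: "cadj (x * y) = cadj y * cadj x"
    and cadj_cadj: "cadj (cadj x) = x"
    and cstar_identity: "norm (cadj x * x) = (norm x)\<^sup>2"

instantiation complex :: unital_cstar_algebra
begin

definition "cscale_complex = (\<lambda>c x :: complex. c * x)"
definition "cadj_complex = cnj"

instance
  by standard
    (auto simp: cscale_complex_def cadj_complex_def algebra_simps norm_mult power2_eq_square
      scaleR_conv_of_real)

end

definition magic_unitary ::
    "'i set \<Rightarrow> 'j set \<Rightarrow> ('i \<Rightarrow> 'j \<Rightarrow> 'x::unital_cstar_algebra) \<Rightarrow> bool" where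
  "magic_unitary I J U \<longleftrightarrow> finite I \<and> finite J \<and>
     (\<forall>i\<in>I. \<forall>j\<in>J. U i j = (U i j)\<^sup>2 \<and> U i j = cadj (U i j) \<and>
        (\<Sum>k\<in>I. U k j) = 1 \<and> (\<Sum>k\<in>J. U i k) = 1)"

text \<open>
  Finite simple graphs are those satisfying the locale predicate \<open>Digraph.graph\<close>: finite, symmetric
  and without loops or parallel arcs, every undirected edge being a pair of opposite arcs. The
  qualified names avoid \<open>Map.graph\<close> and the topological \<open>connected\<close>.
\<close>

definition adj_matrix :: "('a, 'e) pre_digraph \<Rightarrow> 'a \<Rightarrow> 'a \<Rightarrow> 'x::zero_neq_one" where
  "adj_matrix G u v = of_bool ((u, v) \<in> arcs_ends G)"

definition quantum_isomorphism ::
    "('b \<Rightarrow> 'a \<Rightarrow> 'x::unital_cstar_algebra) \<Rightarrow> ('a, 'e) pre_digraph \<Rightarrow> ('b, 'f) pre_digraph \<Rightarrow> bool"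
  where
  "quantum_isomorphism U G H \<longleftrightarrow>
     card (verts G) = card (verts H) \<and>
     magic_unitary (verts H) (verts G) U \<and>
     (\<forall>i\<in>verts H. \<forall>j\<in>verts G.
        (\<Sum>k\<in>verts G. U i k * adj_matrix G k j) = (\<Sum>k\<in>verts H. adj_matrix H i k * U k j))"

text \<open>
  The coefficient algebra is the type argument. HOL has no existential quantifier over types, so
  ``over some algebra'' is expressed by a hypothesis whose type variable \<open>'x\<close> is arbitrary.
\<close>

definition quantum_isomorphic ::
    "'x::unital_cstar_algebra itself \<Rightarrow> ('a, 'e) pre_digraph \<Rightarrow> ('b, 'f) pre_digraph \<Rightarrow> bool" where
  "quantum_isomorphic T G H \<longleftrightarrow> (\<exists>U :: 'b \<Rightarrow> 'a \<Rightarrow> 'x. quantum_isomorphism U G H)"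

text \<open>\<open>Digraph_Component.connected\<close> includes nonemptiness, so the empty graph has no component.\<close>

definition components :: "('a, 'e) pre_digraph \<Rightarrow> ('a, 'e) pre_digraph set" where
  "components G = {C. pre_digraph.max_subgraph G Digraph_Component.connected C}"

definition cut_vertices :: "('a, 'e) pre_digraph \<Rightarrow> 'a set" where
  "cut_vertices G = {v \<in> verts G. card (verts G) = 1 \<or>
     card (verts G) \<ge> 2 \<and> card (components G) < card (components (pre_digraph.del_vert G v))}"

definition two_connected :: "('a, 'e) pre_digraph \<Rightarrow> bool" where
  "two_connected G \<longleftrightarrow> Digraph.graph G \<and> Digraph_Component.connected G \<and>
     (\<forall>v\<in>verts G. Digraph_Component.connected (pre_digraph.del_vert G v) \<and>
        verts (pre_digraph.del_vert G v) \<noteq> {})"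

text \<open>
  \<open>subgraph\<close> also admits asymmetric subdigraphs; the conjunct \<open>Digraph.graph\<close> in
  \<^const>\<open>two_connected\<close> restricts blocks, and their competitors for maximality, to undirected
  subgraphs.
\<close>

definition blocks :: "('a, 'e) pre_digraph \<Rightarrow> ('a, 'e) pre_digraph set" where
  "blocks G = {B. pre_digraph.max_subgraph G two_connected B}"

end

theory Submission
  imports Defs "HOL-Computational_Algebra.Formal_Power_Series"
begin

text \<open>
  The entries of a magic unitary \<open>U\<close> in a fixed row or column are orthogonal projections. Hence
  \<open>U i k * U j l \<noteq> 0\<close> (written \<open>tied i k j l\<close>) forces the pairs \<open>(k, l)\<close> of \<open>G\<close> and \<open>(i, j)\<close> of \<open>H\<close> to
  agree on every invariant obtained from adjacency by sums over a third vertex, and double sums of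
  such invariants over all pairs agree for \<open>G\<close> and \<open>H\<close>.

  Counting walks is such an invariant. With \<open>P u w\<close> the generating function of the walks from \<open>u\<close> to
  \<open>w\<close>, a vertex \<open>v \<noteq> u, w\<close> lies on all walks from \<open>u\<close> to \<open>w\<close> iff \<open>P u w * P v v = P u v * P v w\<close>. So
  the number of pairs separated by \<open>v\<close> is an invariant, which settles cut vertices. Two distinct
  connected vertices are in a common block iff no vertex separates them; if \<open>n\<close> vertices are in a
  common block with both, their block has \<open>n + 2\<close> vertices, so that summing \<open>1 / ((n + 1) (n + 2))\<close>
  over all such ordered pairs counts the blocks.
\<close>

subsection \<open>Projections with sum one\<close>

lemma norm_mult_le_one:
  fixes a b :: "'x::real_normed_algebra"
  assumes "norm a \<le> 1" "norm b \<le> 1"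
  shows "norm (a * b) \<le> 1"
  using norm_mult_ineq[of a b] mult_le_one[OF assms(1) norm_ge_zero assms(2)] by (rule order_trans)

text \<open>
  The map \<open>f x = 3/2 x - 1/2 x\<^sup>3\<close> preserves the hypotheses, because \<open>e \<plusminus> f x\<close> is a convex combination
  of products of \<open>e + x\<close> and \<open>e - x\<close>. The hypotheses also bound \<open>norm x\<close> by \<open>1/2\<close>, so \<open>f\<close> expands the
  norm by \<open>11/8\<close>, and iterating it forces \<open>x = 0\<close>.
\<close>

lemma unit_ball_corner_extreme:
  fixes e x :: "'x::real_normed_algebra"
  assumes ee: "e * e = e" and ex: "e * x = x" and xe: "x * e = x"
    and np: "norm (e + x) \<le> 1" and nm: "norm (e - x) \<le> 1"
  shows "x = 0"
proof -
  have quarter: "norm ((1/4) *\<^sub>R (a * a * a + 3 *\<^sub>R (a * a * b))) \<le> 1"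
    if "norm a \<le> 1" "norm b \<le> 1" for a b :: 'x
  proof -
    have "norm (a * a * a) \<le> 1" "norm (a * a * b) \<le> 1"
      using that by (auto intro!: norm_mult_le_one)
    then have "norm (a * a * a) + norm (3 *\<^sub>R (a * a * b)) \<le> 1 + 3" by simp
    moreover have "norm (a * a * a + 3 *\<^sub>R (a * a * b)) \<le> norm (a * a * a) + norm (3 *\<^sub>R (a * a * b))"
      by (rule norm_triangle_ineq)
    ultimately show ?thesis by simp
  qed
  define K where "K = {y::'x. e * y = y \<and> y * e = y \<and> norm (e + y) \<le> 1 \<and> norm (e - y) \<le> 1}"
  define f where "f y = (3/2) *\<^sub>R y - (1/2) *\<^sub>R (y * y * y)" for y :: 'x
  have half: "norm y \<le> 1/2" if "y \<in> K" for y
  proof -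
    have y: "e * y = y" "y * e = y" "norm (e + y) \<le> 1" "norm (e - y) \<le> 1"
      using that by (auto simp: K_def)
    \<comment> \<open>\<open>4 y\<close> is a difference of two squares of contractions, since
      \<open>e\<close> acts as a unit on \<open>y\<close>.\<close>
    have "4 *\<^sub>R y = 2 *\<^sub>R (2 *\<^sub>R y)" by simp
    also have "\<dots> = (e + y) * (e + y) - (e - y) * (e - y)"
      unfolding scaleR_2 using y ee by (simp add: algebra_simps)
    finally have "4 *\<^sub>R y = (e + y) * (e + y) - (e - y) * (e - y)" .
    moreover have "norm ((e + y) * (e + y)) \<le> 1" "norm ((e - y) * (e - y)) \<le> 1"
      using y by (auto intro: norm_mult_le_one)
    ultimately have "norm (4 *\<^sub>R y) \<le> 1 + 1"
      by (smt (verit) norm_triangle_ineq4)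
    then show ?thesis by simp
  qed
  have fK: "f y \<in> K" if "y \<in> K" for y
  proof -
    have y: "e * y = y" "y * e = y" "norm (e + y) \<le> 1" "norm (e - y) \<le> 1"
      using that by (auto simp: K_def)
    have eyz: "e * (y * z) = y * z" "y * (e * z) = y * z" for z
      using y by (simp_all flip: mult.assoc)
    \<comment> \<open>Scalar multiples become repeated sums, so that ring normalisation alone can
      compare both sides of the cubic identities below.\<close>
    have num: "2 *\<^sub>R v = v + v" "3 *\<^sub>R v = v + (v + v)" "4 *\<^sub>R v = v + v + (v + v)"
      "6 *\<^sub>R v = v + v + (v + v + (v + v))" for v :: 'x
      using scaleR_add_left[of 1 1 v] scaleR_add_left[of 1 2 v] scaleR_add_left[of 2 2 v]
        scaleR_add_left[of 2 4 v] by simp_all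
    have four: "4 *\<^sub>R (e + f y) = 4 *\<^sub>R e + 6 *\<^sub>R y - 2 *\<^sub>R (y * y * y)"
      "4 *\<^sub>R (e - f y) = 4 *\<^sub>R e - 6 *\<^sub>R y + 2 *\<^sub>R (y * y * y)"
      by (simp_all add: f_def scaleR_add_right scaleR_diff_right)
    have "4 *\<^sub>R (e + f y) = (e + y) * (e + y) * (e + y) + 3 *\<^sub>R ((e + y) * (e + y) * (e - y))"
         "4 *\<^sub>R (e - f y) = (e - y) * (e - y) * (e - y) + 3 *\<^sub>R ((e - y) * (e - y) * (e + y))"
      unfolding four unfolding num using y ee eyz by (simp_all add: algebra_simps)
    then have "e + f y = (1/4) *\<^sub>R ((e + y) * (e + y) * (e + y) + 3 *\<^sub>R ((e + y) * (e + y) * (e - y)))"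
         "e - f y = (1/4) *\<^sub>R ((e - y) * (e - y) * (e - y) + 3 *\<^sub>R ((e - y) * (e - y) * (e + y)))"
      by (metis divideR_right zero_neq_numeral inverse_eq_divide)+
    then have "norm (e + f y) \<le> 1" "norm (e - f y) \<le> 1"
      using quarter y by presburger+
    moreover have "e * f y = f y" "f y * e = f y"
      using y eyz by (auto simp: f_def algebra_simps)
    ultimately show ?thesis by (simp add: K_def)
  qed
  have growth: "(11/8) * norm y \<le> norm (f y)" if "y \<in> K" for y
  proof -
    have "norm (y * y * y) \<le> norm y * norm y * norm y"
      by (meson mult_right_mono norm_ge_zero norm_mult_ineq order_trans)
    \<comment> \<open>Applying \<open>half\<close> to two of the three factors leaves
      \<open>1/4\<close>, which gives the growth factor \<open>3/2 - 1/8 = 11/8\<close>.\<close>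
    also have "\<dots> \<le> (1/2) * (1/2) * norm y"
      using half[OF that] by (intro mult_mono) auto
    finally have "norm ((1/2) *\<^sub>R (y * y * y)) \<le> (1/8) * norm y" by simp
    moreover have "norm ((3/2) *\<^sub>R y) - norm ((1/2) *\<^sub>R (y * y * y)) \<le> norm (f y)"
      unfolding f_def by (rule norm_triangle_ineq2)
    ultimately show ?thesis by simp
  qed
  have "x \<in> K" using assms by (simp add: K_def)
  have pow: "(11/8) ^ n * norm y \<le> 1/2" if "y \<in> K" for n y
    using that
  proof (induction n arbitrary: y)
    case 0 then show ?case using half by simp
  next
    case (Suc n)
    have "(11/8) ^ Suc n * norm y \<le> (11/8) ^ n * norm (f y)"
      using growth[OF Suc.prems] by (simp add: mult_left_mono field_simps)
    then show ?case using Suc.IH[OF fK[OF Suc.prems]] by linarith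
  qed
  show ?thesis
  proof (rule ccontr)
    assume "x \<noteq> 0"
    obtain n where "1 / norm x < (11/8 :: real) ^ n"
      using real_arch_pow[of "11/8" "1 / norm x"] by auto
    then have "1 < (11/8) ^ n * norm x" using \<open>x \<noteq> 0\<close> by (simp add: field_simps)
    then show False using pow[OF \<open>x \<in> K\<close>, of n] by simp
  qed
qed

lemma cadj_one: "cadj 1 = (1::'x::unital_cstar_algebra)"
  by (metis cadj_cadj cadj_mult mult_1 mult_1_right)

lemma cadj_zero: "cadj 0 = (0::'x::unital_cstar_algebra)"
  by (metis add_0 add_right_cancel cadj_add)

lemma cadj_diff: "cadj (x - y) = cadj x - cadj (y::'x::unital_cstar_algebra)"
  by (metis add_diff_cancel_right' cadj_add diff_add_cancel)

definition projection :: "'x::unital_cstar_algebra \<Rightarrow> bool" where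
  "projection p \<longleftrightarrow> p * p = p \<and> cadj p = p"

lemma norm_projection_le: "projection p \<Longrightarrow> norm p \<le> 1"
  using cstar_identity[of p] unfolding projection_def
  by (metis mult_cancel_right1 norm_eq_zero order.refl power2_eq_square zero_le_one)

text \<open>The element \<open>1 - 2 p\<close> is a self-adjoint involution, so the C*-identity
  makes the square of its norm equal to \<open>1\<close>.\<close>

lemma norm_one_minus_twice_projection:
  assumes "projection p"
  shows "norm (1 - 2 *\<^sub>R p) = 1"
proof -
  have p: "p * p = p" "cadj p = p" using assms by (auto simp: projection_def)
  have "cadj (1 - 2 *\<^sub>R p) = 1 - 2 *\<^sub>R p"
    by (simp add: cadj_diff cadj_one scaleR_2 cadj_add p)
  moreover have "(1 - 2 *\<^sub>R p) * (1 - 2 *\<^sub>R p) = 1"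
    by (simp add: algebra_simps p scaleR_2)
  ultimately have "(norm (1 - 2 *\<^sub>R p))\<^sup>2 = 1"
    using cstar_identity[of "1 - 2 *\<^sub>R p"] by simp
  then show ?thesis by (smt (verit) norm_ge_zero power2_eq_1_iff)
qed

text \<open>
  With \<open>e = p i\<close>, the elements \<open>e * p k * e\<close> for \<open>k \<noteq> i\<close> sum to \<open>0\<close> and each \<open>e - 2 e * p k * e\<close> is a
  contraction. Averaging these shows \<open>norm (e \<plusminus> x) \<le> 1\<close> for \<open>x\<close> a multiple of \<open>e * p j * e\<close>. This
  avoids the theory of positive elements.
\<close>

lemma projections_orthogonal:
  fixes p :: "'i \<Rightarrow> 'x::unital_cstar_algebra"
  assumes "finite I" and proj: "\<And>i. i \<in> I \<Longrightarrow> projection (p i)"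
    and one: "(\<Sum>i\<in>I. p i) = 1" and ij: "i \<in> I" "j \<in> I" "i \<noteq> j"
  shows "p i * p j = 0"
proof -
  define e where "e = p i"
  have e: "e * e = e" "cadj e = e" "norm e \<le> 1"
    using proj[OF ij(1)] norm_projection_le[OF proj[OF ij(1)]] by (auto simp: e_def projection_def)
  have pj: "p j * p j = p j" "cadj (p j) = p j"
    using proj[OF ij(2)] by (auto simp: projection_def)
  define a where "a k = e * p k * e" for k
  define m where "m = real (card (I - {i}))"
  have m: "m \<ge> 1" using ij \<open>finite I\<close>
    unfolding m_def by (metis Diff_iff One_nat_def Suc_leI card_gt_0_iff empty_iff finite_Diff insert_iff of_nat_1 of_nat_mono)
  have cont: "norm (e - 2 *\<^sub>R a k) \<le> 1" if "k \<in> I" for k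
  proof -
    have "e - 2 *\<^sub>R a k = e * (1 - 2 *\<^sub>R p k) * e"
      by (simp add: a_def algebra_simps e)
    also have "norm \<dots> \<le> norm e * norm (1 - 2 *\<^sub>R p k) * norm e"
      by (meson mult_right_mono norm_ge_zero norm_mult_ineq order_trans)
    also have "\<dots> \<le> 1"
      using e by (simp add: norm_one_minus_twice_projection[OF proj[OF that]] mult_le_one)
    finally show ?thesis .
  qed
  have psum: "(\<Sum>k\<in>I - {i}. p k) = 1 - e"
    using one ij \<open>finite I\<close> by (simp add: sum_diff1 e_def)
  have "(\<Sum>k\<in>I - {i}. a k) = e * (\<Sum>k\<in>I - {i}. p k) * e"
    by (simp add: a_def sum_distrib_left sum_distrib_right)
  also have "\<dots> = 0"
    unfolding psum by (simp add: algebra_simps e)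
  finally have "(\<Sum>k\<in>I - {i}. a k) = 0" .
  then have suma: "(\<Sum>k\<in>I - {i,j}. a k) = - a j"
    using ij \<open>finite I\<close> by (subst Diff_insert2) (simp add: sum_diff1)
  have cardm: "real (card (I - {i,j})) = m - 1"
    using ij \<open>finite I\<close> card_mono[of I "{i,j}"] unfolding m_def
    by (subst Diff_insert2) (simp add: card_Diff_singleton_if of_nat_diff)
  have "norm (e + (2/m) *\<^sub>R a j) \<le> 1"
  proof -
    \<comment> \<open>By \<open>suma\<close>, \<open>m e + 2 a j\<close> is \<open>e\<close> plus
      \<open>m - 1\<close> contractions; dividing by \<open>m\<close> averages them.\<close>
    have "(\<Sum>k\<in>I - {i,j}. e - 2 *\<^sub>R a k) = (m - 1) *\<^sub>R e + 2 *\<^sub>R a j"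
      by (simp add: sum_subtractf suma cardm sum_constant_scaleR del: sum_constant flip: scaleR_sum_right)
    then have "m *\<^sub>R e + 2 *\<^sub>R a j = e + (\<Sum>k\<in>I - {i,j}. e - 2 *\<^sub>R a k)"
      by (simp add: algebra_simps)
    moreover have "norm (\<Sum>k\<in>I - {i,j}. e - 2 *\<^sub>R a k) \<le> m - 1"
      using sum_norm_bound[of "I - {i,j}" "\<lambda>k. e - 2 *\<^sub>R a k" 1] cont by (simp add: cardm)
    ultimately have "norm (m *\<^sub>R e + 2 *\<^sub>R a j) \<le> m"
      using e(3) by (smt (verit) norm_triangle_ineq)
    moreover have "m *\<^sub>R e + 2 *\<^sub>R a j = m *\<^sub>R (e + (2/m) *\<^sub>R a j)"
      using m by (simp add: algebra_simps)
    ultimately show ?thesis using m by simp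
  qed
  moreover have "norm (e - (2/m) *\<^sub>R a j) \<le> 1"
  proof -
    \<comment> \<open>For the other sign, \<open>m - 1\<close> copies of \<open>e\<close> are
      averaged with the single contraction \<open>e - 2 a j\<close>.\<close>
    have "m *\<^sub>R (e - (2/m) *\<^sub>R a j) = (m - 1) *\<^sub>R e + (e - 2 *\<^sub>R a j)"
      using m by (simp add: algebra_simps)
    moreover have "norm ((m - 1) *\<^sub>R e) \<le> m - 1" using m e(3) by (simp add: mult_left_le)
    ultimately have "norm (m *\<^sub>R (e - (2/m) *\<^sub>R a j)) \<le> m"
      using cont[OF ij(2)] by (smt (verit) norm_triangle_ineq)
    then show ?thesis using m by simp
  qed
  ultimately have "(2/m) *\<^sub>R a j = 0"
    by (intro unit_ball_corner_extreme[of e]) (simp_all add: e(1) a_def mult.assoc, simp add: e(1) flip: mult.assoc)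
  then have "a j = 0" using m by simp
  \<comment> \<open>This product is \<open>a j\<close>, so the C*-identity yields
    \<open>p j * e = 0\<close>, and taking the adjoint reverses the factors.\<close>
  then have "cadj (p j * e) * (p j * e) = 0"
    unfolding a_def by (simp add: cadj_mult e pj) (metis mult.assoc pj(1))
  then have "p j * e = 0" using cstar_identity[of "p j * e"] by simp
  then have "cadj (p j * e) = 0" by (simp add: cadj_zero)
  then show ?thesis by (simp add: cadj_mult e pj e_def[symmetric])
qed

subsection \<open>Magic unitaries\<close>

locale orthogonal_magic_unitary =
  fixes U :: "'b \<Rightarrow> 'a \<Rightarrow> 'x::unital_cstar_algebra" and W :: "'b set" and V :: "'a set"
  assumes finite_V: "finite V" and finite_W: "finite W"
    and proj: "i \<in> W \<Longrightarrow> k \<in> V \<Longrightarrow> projection (U i k)"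
    and row_sum: "i \<in> W \<Longrightarrow> (\<Sum>k\<in>V. U i k) = 1"
    and col_sum: "k \<in> V \<Longrightarrow> (\<Sum>i\<in>W. U i k) = 1"
begin

lemma idem: "i \<in> W \<Longrightarrow> k \<in> V \<Longrightarrow> U i k * U i k = U i k"
  and self_adjoint: "i \<in> W \<Longrightarrow> k \<in> V \<Longrightarrow> cadj (U i k) = U i k"
  using proj by (auto simp: projection_def)

lemma row_orth: "i \<in> W \<Longrightarrow> k \<in> V \<Longrightarrow> l \<in> V \<Longrightarrow> k \<noteq> l \<Longrightarrow> U i k * U i l = 0"
  by (rule projections_orthogonal[OF finite_V _ row_sum]) (auto intro: proj)

lemma col_orth: "i \<in> W \<Longrightarrow> j \<in> W \<Longrightarrow> k \<in> V \<Longrightarrow> i \<noteq> j \<Longrightarrow> U i k * U j k = 0"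
  using projections_orthogonal[OF finite_W _ col_sum, of k i j] proj by auto

definition tied :: "'b \<Rightarrow> 'a \<Rightarrow> 'b \<Rightarrow> 'a \<Rightarrow> bool" where
  "tied i k j l \<longleftrightarrow> i \<in> W \<and> k \<in> V \<and> j \<in> W \<and> l \<in> V \<and> U i k * U j l \<noteq> 0"

text \<open>Taking adjoints reverses a nonzero product of entries, which gives symmetry;
  orthogonality within rows and columns gives the last equivalence.\<close>

lemma tiedD:
  assumes "tied i k j l"
  shows "i \<in> W" "k \<in> V" "j \<in> W" "l \<in> V" "tied j l i k" "tied i k i k" "tied j l j l" "k = l \<longleftrightarrow> i = j"
proof -
  show *: "i \<in> W" "k \<in> V" "j \<in> W" "l \<in> V" using assms by (auto simp: tied_def)
  have nz: "U i k * U j l \<noteq> 0" using assms by (simp add: tied_def)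
  have "cadj (U j l * U i k) = U i k * U j l" using * by (simp add: cadj_mult self_adjoint)
  then have "U j l * U i k \<noteq> 0" using nz by (metis cadj_zero)
  then show "tied j l i k" using * by (simp add: tied_def)
  have "U i k \<noteq> 0" "U j l \<noteq> 0" using nz by auto
  then show "tied i k i k" "tied j l j l" using * by (auto simp: tied_def idem)
  show "k = l \<longleftrightarrow> i = j" using nz * row_orth col_orth by metis
qed

text \<open>Insert the column sum \<open>1\<close> over \<open>p\<close> between
  \<open>U i k\<close> and \<open>U j l\<close>. A nonzero triple product ties \<open>(p, m)\<close>
  to both ends, so \<open>f m\<close> may be replaced by \<open>g p\<close>; the row sum over
  \<open>m\<close> then removes the middle factor. Comparing coefficients of the nonzero
  \<open>U i k * U j l\<close> finishes.\<close>

lemma sum_eq_if_tied: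
  fixes f :: "'a \<Rightarrow> real" and g :: "'b \<Rightarrow> real"
  assumes t: "tied i k j l"
    and eq: "\<And>p m. tied i k p m \<Longrightarrow> tied p m j l \<Longrightarrow> f m = g p"
  shows "(\<Sum>m\<in>V. f m) = (\<Sum>p\<in>W. g p)"
proof -
  note ijkl = tiedD[OF t]
  let ?T = "\<lambda>p m. U i k * U p m * U j l"
  have pt: "f m *\<^sub>R ?T p m = g p *\<^sub>R ?T p m" if "p \<in> W" "m \<in> V" for p m
  proof (cases "?T p m = 0")
    case False
    then have "U i k * U p m \<noteq> 0" "U p m * U j l \<noteq> 0"
      by (metis mult_zero_left, metis mult.assoc mult_zero_right)
    then show ?thesis using eq[of p m] that ijkl by (auto simp: tied_def)
  qed auto
  have "(\<Sum>m\<in>V. f m) *\<^sub>R (U i k * U j l) = (\<Sum>m\<in>V. f m *\<^sub>R (U i k * (\<Sum>p\<in>W. U p m) * U j l))"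
    by (simp add: col_sum scaleR_left.sum)
  also have "\<dots> = (\<Sum>m\<in>V. \<Sum>p\<in>W. f m *\<^sub>R ?T p m)"
    by (simp add: sum_distrib_left sum_distrib_right scaleR_sum_right)
  also have "\<dots> = (\<Sum>m\<in>V. \<Sum>p\<in>W. g p *\<^sub>R ?T p m)"
    using pt by (intro sum.cong) auto
  also have "\<dots> = (\<Sum>p\<in>W. \<Sum>m\<in>V. g p *\<^sub>R ?T p m)" by (rule sum.swap)
  also have "\<dots> = (\<Sum>p\<in>W. g p *\<^sub>R (U i k * (\<Sum>m\<in>V. U p m) * U j l))"
    by (simp add: sum_distrib_left sum_distrib_right scaleR_sum_right)
  also have "\<dots> = (\<Sum>p\<in>W. g p) *\<^sub>R (U i k * U j l)"
    by (simp add: row_sum scaleR_left.sum)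
  finally show ?thesis using t by (simp add: tied_def)
qed

text \<open>Existence means that a sum of indicators is nonzero.\<close>

lemma ex_iff_if_tied:
  assumes "tied i k j l"
    and "\<And>p m. tied i k p m \<Longrightarrow> tied p m j l \<Longrightarrow> A m \<longleftrightarrow> B p"
  shows "(\<exists>m\<in>V. A m) \<longleftrightarrow> (\<exists>p\<in>W. B p)"
proof -
  have "(\<Sum>m\<in>V. of_bool (A m)) = (\<Sum>p\<in>W. of_bool (B p) :: real)"
    using assms by (intro sum_eq_if_tied) auto
  then have "(\<Sum>m\<in>V. of_bool (A m) :: real) = 0 \<longleftrightarrow> (\<Sum>p\<in>W. of_bool (B p) :: real) = 0" by simp
  then show ?thesis
    using finite_V finite_W by (subst (asm) (1 2) sum_nonneg_eq_0_iff) auto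
qed

text \<open>Expand \<open>1\<close> into the product of the column sums of \<open>k\<close> and
  \<open>l\<close>, exchange coefficients wherever the product of entries survives, and contract the
  row sums of \<open>i\<close> and \<open>j\<close>.\<close>

lemma double_sum_eq:
  fixes f :: "'a \<Rightarrow> 'a \<Rightarrow> real" and g :: "'b \<Rightarrow> 'b \<Rightarrow> real"
  assumes eq: "\<And>i j k l. tied i k j l \<Longrightarrow> f k l = g i j"
  shows "(\<Sum>k\<in>V. \<Sum>l\<in>V. f k l) = (\<Sum>i\<in>W. \<Sum>j\<in>W. g i j)"
proof -
  have pt: "f k l *\<^sub>R (U i k * U j l) = g i j *\<^sub>R (U i k * U j l)"
    if "i \<in> W" "j \<in> W" "k \<in> V" "l \<in> V" for i j k l
    using eq[of i k j l] that by (cases "U i k * U j l = 0") (auto simp: tied_def)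
  have "(\<Sum>k\<in>V. \<Sum>l\<in>V. f k l) *\<^sub>R (1::'x)
      = (\<Sum>k\<in>V. \<Sum>l\<in>V. f k l *\<^sub>R ((\<Sum>i\<in>W. U i k) * (\<Sum>j\<in>W. U j l)))"
    by (simp add: col_sum scaleR_left.sum)
  also have "\<dots> = (\<Sum>k\<in>V. \<Sum>l\<in>V. \<Sum>i\<in>W. \<Sum>j\<in>W. f k l *\<^sub>R (U i k * U j l))"
    by (simp add: sum_product scaleR_sum_right)
  also have "\<dots> = (\<Sum>k\<in>V. \<Sum>l\<in>V. \<Sum>i\<in>W. \<Sum>j\<in>W. g i j *\<^sub>R (U i k * U j l))"
    using pt by (intro sum.cong) auto
  also have "\<dots> = (\<Sum>k\<in>V. \<Sum>i\<in>W. \<Sum>l\<in>V. \<Sum>j\<in>W. g i j *\<^sub>R (U i k * U j l))"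
    by (intro sum.cong refl sum.swap)
  also have "\<dots> = (\<Sum>i\<in>W. \<Sum>k\<in>V. \<Sum>j\<in>W. \<Sum>l\<in>V. g i j *\<^sub>R (U i k * U j l))"
    by (subst sum.swap) (intro sum.cong refl sum.swap)
  also have "\<dots> = (\<Sum>i\<in>W. \<Sum>j\<in>W. \<Sum>k\<in>V. \<Sum>l\<in>V. g i j *\<^sub>R (U i k * U j l))"
    by (intro sum.cong refl sum.swap)
  also have "\<dots> = (\<Sum>i\<in>W. \<Sum>j\<in>W. g i j *\<^sub>R ((\<Sum>k\<in>V. U i k) * (\<Sum>l\<in>V. U j l)))"
    by (simp only: sum_product scaleR_sum_right)
  also have "\<dots> = (\<Sum>i\<in>W. \<Sum>j\<in>W. g i j) *\<^sub>R (1::'x)"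
    by (simp add: row_sum scaleR_left.sum)
  finally show ?thesis by simp
qed

text \<open>A cardinality is a double sum supported on the diagonal, and tied pairs preserve
  equality of vertices.\<close>

lemma card_eq:
  assumes "\<And>i k. tied i k i k \<Longrightarrow> A k \<longleftrightarrow> B i"
  shows "card {k\<in>V. A k} = card {i\<in>W. B i}"
proof -
  have "(\<Sum>k\<in>V. \<Sum>l\<in>V. if k = l then of_bool (A k) else 0) =
      (\<Sum>i\<in>W. \<Sum>j\<in>W. if i = j then of_bool (B i) else (0::real))"
  proof (rule double_sum_eq)
    fix i j k l assume t: "tied i k j l"
    show "(if k = l then of_bool (A k) else 0) = (if i = j then of_bool (B i) else (0::real))"
      using assms[of i k] tiedD(6,8)[OF t] by auto
  qed
  then have "(\<Sum>k\<in>V. of_bool (A k)) = (\<Sum>i\<in>W. of_bool (B i) :: real)"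
    using finite_V finite_W by simp
  moreover have "(\<Sum>x\<in>X. of_bool (P x)) = real (card {x\<in>X. P x})" if "finite X"
    for X :: "'c set" and P
    using that by (simp add: Int_def)
  ultimately show ?thesis using finite_V finite_W by (metis of_nat_eq_iff)
qed

end

lemma quantum_isomorphism_orthogonal:
  assumes "quantum_isomorphism U G H"
  shows "orthogonal_magic_unitary U (verts H) (verts G)"
proof -
  have "finite (verts G)" "finite (verts H)" "card (verts G) = card (verts H)"
    using assms by (auto simp: quantum_isomorphism_def magic_unitary_def)
  \<comment> \<open>In \<open>magic_unitary\<close> the sum conditions range over pairs of indices,
    so they are vacuous when one vertex set is empty; then the other one must be empty too.\<close>
  then have "verts G = {} \<longleftrightarrow> verts H = {}" by auto
  then show ?thesis
    using assms unfolding quantum_isomorphism_def magic_unitary_def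
    by unfold_locales (auto simp: projection_def power2_eq_square)
qed

text \<open>Multiply entry \<open>(i, l)\<close> of the intertwining relation by
  \<open>U i k\<close> on the left and \<open>U j l\<close> on the right: row orthogonality keeps
  only \<open>m = k\<close>, column orthogonality only \<open>p = j\<close>.\<close>

lemma quantum_isomorphism_adjacency:
  fixes U :: "'b \<Rightarrow> 'a \<Rightarrow> 'x::unital_cstar_algebra"
  assumes "quantum_isomorphism U G H"
    and t: "orthogonal_magic_unitary.tied U (verts H) (verts G) i k j l"
  shows "(k, l) \<in> arcs_ends G \<longleftrightarrow> (i, j) \<in> arcs_ends H"
proof -
  interpret orthogonal_magic_unitary U "verts H" "verts G"
    by (rule quantum_isomorphism_orthogonal[OF assms(1)])
  note ijkl = tiedD(1-4)[OF t]
  have A: "x * adj_matrix G k l = adj_matrix G k l * x" for x :: 'x and k l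
    by (simp add: adj_matrix_def)
  have "U i k * (\<Sum>m\<in>verts G. U i m * adj_matrix G m l) * U j l =
      (\<Sum>m\<in>verts G. if m = k then U i k * adj_matrix G k l * U j l else 0)"
    unfolding sum_distrib_left sum_distrib_right
    using ijkl row_orth[of i k] by (intro sum.cong) (auto simp: idem simp flip: mult.assoc)
  also have "\<dots> = adj_matrix G k l * (U i k * U j l)"
    using ijkl finite_V by (simp add: A mult.assoc)
  finally have 1: "U i k * (\<Sum>m\<in>verts G. U i m * adj_matrix G m l) * U j l = adj_matrix G k l * (U i k * U j l)" .
  have "U i k * (\<Sum>p\<in>verts H. adj_matrix H i p * U p l) * U j l =
      (\<Sum>p\<in>verts H. if p = j then U i k * adj_matrix H i j * U j l else 0)"
    unfolding sum_distrib_left sum_distrib_right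
    using ijkl col_orth[of _ j l] by (intro sum.cong) (auto simp: idem mult.assoc)
  also have "\<dots> = adj_matrix H i j * (U i k * U j l)"
    using ijkl finite_W by (simp add: adj_matrix_def)
  finally have "adj_matrix G k l * (U i k * U j l) = adj_matrix H i j * (U i k * U j l)"
    using 1 assms(1) ijkl by (simp add: quantum_isomorphism_def)
  then show ?thesis
    using t by (cases "(k, l) \<in> arcs_ends G"; cases "(i, j) \<in> arcs_ends H")
      (auto simp: tied_def adj_matrix_def)
qed

subsection \<open>Walk generating functions\<close>

primrec walks :: "'a set \<Rightarrow> 'a rel \<Rightarrow> nat \<Rightarrow> 'a \<Rightarrow> 'a \<Rightarrow> real" where
  "walks V E 0 u w = of_bool (u = w)"
| "walks V E (Suc n) u w = (\<Sum>m\<in>V. walks V E n u m * of_bool ((m, w) \<in> E))"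

text \<open>Formal power series need no convergence and form an integral domain, so nonzero factors
  can be cancelled.\<close>

definition walk_gf :: "'a set \<Rightarrow> 'a rel \<Rightarrow> 'a \<Rightarrow> 'a \<Rightarrow> real fps" where
  "walk_gf V E u w = Abs_fps (\<lambda>n. walks V E n u w)"

text \<open>The vertex \<open>v\<close> survives as an isolated point, so \<open>(v, v)\<close>
  stays in the reflexive transitive closure.\<close>

definition avoiding :: "'a rel \<Rightarrow> 'a \<Rightarrow> 'a rel" where
  "avoiding E v = {(x, y) \<in> E. x \<noteq> v \<and> y \<noteq> v}"

definition separates :: "'a rel \<Rightarrow> 'a \<Rightarrow> 'a \<Rightarrow> 'a \<Rightarrow> bool" where
  "separates E v u w \<longleftrightarrow> u \<noteq> v \<and> v \<noteq> w \<and> (u, w) \<in> E\<^sup>* \<and> (u, w) \<notin> (avoiding E v)\<^sup>*"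

lemma walks_nonneg: "walks V E n u w \<ge> 0"
  by (induction n arbitrary: w) (auto intro!: sum_nonneg)

text \<open>Nonnegativity excludes cancellation in the recursive sum.\<close>

lemma walks_nonzero_iff:
  assumes "finite V" "E \<subseteq> V \<times> V"
  shows "walks V E n u w \<noteq> 0 \<longleftrightarrow> (u, w) \<in> E ^^ n"
proof (induction n arbitrary: w)
  case (Suc n)
  have "walks V E (Suc n) u w \<noteq> 0 \<longleftrightarrow> (\<exists>m\<in>V. walks V E n u m * of_bool ((m, w) \<in> E) \<noteq> 0)"
    using \<open>finite V\<close> by (auto simp: sum_nonneg_eq_0_iff walks_nonneg)
  also have "\<dots> \<longleftrightarrow> (u, w) \<in> E ^^ Suc n"
    using Suc assms(2) by (auto simp: relcomp_unfold)
  finally show ?case .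
qed auto

lemma walk_gf_nonzero_iff:
  assumes "finite V" "E \<subseteq> V \<times> V"
  shows "walk_gf V E u w \<noteq> 0 \<longleftrightarrow> (u, w) \<in> E\<^sup>*"
  using walks_nonzero_iff[OF assms] by (auto simp: walk_gf_def fps_eq_iff rtrancl_is_UN_relpow)

text \<open>A walk is empty or has a last arc, for which \<open>fps_X\<close> accounts.\<close>

lemma walk_gf_rec:
  "walk_gf V E u w = of_bool (u = w) + fps_X * (\<Sum>t\<in>V. walk_gf V E u t * of_bool ((t, w) \<in> E))"
proof (rule fps_ext)
  have ob: "f * of_bool P = (if P then f else 0)" "of_bool P = (if P then 1 else 0)"
    for f :: "real fps" and P by auto
  fix n show "fps_nth (walk_gf V E u w) n =
    fps_nth (of_bool (u = w) + fps_X * (\<Sum>t\<in>V. walk_gf V E u t * of_bool ((t, w) \<in> E))) n"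
    by (cases n) (auto simp: walk_gf_def fps_sum_nth ob intro!: sum.cong)
qed

text \<open>First-passage decomposition at \<open>v\<close>: a walk from \<open>u\<close> to \<open>w\<close> either avoids \<open>v\<close>, or is a walk
  from \<open>u\<close> to \<open>v\<close> followed by an excursion from \<open>v\<close> to \<open>w\<close> not returning to \<open>v\<close>.\<close>

lemma walk_gf_avoiding:
  assumes "finite V" "v \<in> V" "u \<in> V" "w \<in> V" "w \<noteq> v"
  shows "walk_gf V E u w = walk_gf V (avoiding E v) u w
    + walk_gf V E u v * (fps_X * (\<Sum>j\<in>V. of_bool ((v, j) \<in> E \<and> j \<noteq> v) * walk_gf V (avoiding E v) j w))"
proof -
  let ?a = "\<lambda>t w. of_bool ((t, w) \<in> E) :: real fps"
  let ?b = "\<lambda>t w. of_bool ((t, w) \<in> avoiding E v) :: real fps"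
  let ?P = "walk_gf V E" and ?Q = "walk_gf V (avoiding E v)"
  \<comment> \<open>The excursions: a first arc out of \<open>v\<close>, then a walk to
    \<open>w\<close> that avoids \<open>v\<close>.\<close>
  define h where "h w = fps_X * (\<Sum>j\<in>V. of_bool ((v, j) \<in> E \<and> j \<noteq> v) * ?Q j w)" for w
  have h: "h w = fps_X * ?a v w + fps_X * (\<Sum>t\<in>V. h t * ?b t w)" if "w \<in> V" "w \<noteq> v" for w
  proof -
    have "h w = fps_X * (\<Sum>j\<in>V. of_bool ((v, j) \<in> E \<and> j \<noteq> v) *
        (of_bool (j = w) + fps_X * (\<Sum>t\<in>V. ?Q j t * ?b t w)))"
      unfolding h_def by (subst walk_gf_rec) simp
    also have "\<dots> = fps_X * (\<Sum>j\<in>V. of_bool ((v, j) \<in> E \<and> j \<noteq> v) * of_bool (j = w))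
        + fps_X * (\<Sum>j\<in>V. of_bool ((v, j) \<in> E \<and> j \<noteq> v) * (fps_X * (\<Sum>t\<in>V. ?Q j t * ?b t w)))"
      by (simp only: distrib_left sum.distrib)
    also have "(\<Sum>j\<in>V. of_bool ((v, j) \<in> E \<and> j \<noteq> v) * of_bool (j = w)) = ?a v w"
      using that \<open>finite V\<close> by (simp add: of_bool_def sum.delta if_distrib[where f="\<lambda>x. _ * x"] cong: if_cong)
    also have "(\<Sum>j\<in>V. of_bool ((v, j) \<in> E \<and> j \<noteq> v) * (fps_X * (\<Sum>t\<in>V. ?Q j t * ?b t w)))
        = (\<Sum>t\<in>V. h t * ?b t w)"
      unfolding h_def sum_distrib_left sum_distrib_right
      by (subst sum.swap) (simp add: mult_ac)
    finally show ?thesis .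
  qed
  \<comment> \<open>The defect of the claimed identity. It satisfies a homogeneous recursion with a
    factor \<open>fps_X\<close>, so its coefficients vanish one after the other.\<close>
  define d where "d w = ?P u w - ?Q u w - ?P u v * h w" for w
  have d: "d w = fps_X * (\<Sum>t\<in>V. d t * ?b t w)" if "w \<in> V" "w \<noteq> v" for w
  proof -
    have "(\<Sum>t\<in>V. ?P u t * ?a t w) = (\<Sum>t\<in>V. ?P u t * ?b t w + (if t = v then ?P u v * ?a v w else 0))"
      using that by (intro sum.cong) (auto simp: avoiding_def)
    also have "\<dots> = (\<Sum>t\<in>V. ?P u t * ?b t w) + ?P u v * ?a v w"
      using assms by (simp add: sum.distrib)
    finally have "?P u w = of_bool (u = w) + fps_X * ((\<Sum>t\<in>V. ?P u t * ?b t w) + ?P u v * ?a v w)"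
      by (subst walk_gf_rec) simp
    moreover have "?Q u w = of_bool (u = w) + fps_X * (\<Sum>t\<in>V. ?Q u t * ?b t w)"
      by (rule walk_gf_rec)
    moreover have "?P u v * h w = fps_X * (?P u v * ?a v w) + fps_X * (\<Sum>t\<in>V. ?P u v * h t * ?b t w)"
      by (subst h[OF that]) (simp add: sum_distrib_left algebra_simps)
    ultimately show ?thesis
      by (simp add: d_def algebra_simps sum_subtractf sum.distrib)
  qed
  have "fps_nth (d w) n = 0" if "w \<in> V" "w \<noteq> v" for n w
    using that
  proof (induction n arbitrary: w)
    case 0 then show ?case by (subst d) auto
  next
    case (Suc n)
    have "fps_nth (d w) (Suc n) = (\<Sum>t\<in>V. fps_nth (d t * ?b t w) n)"
      by (subst d) (use Suc.prems in \<open>simp_all add: fps_sum_nth\<close>)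
    also have "\<dots> = 0"
      \<comment> \<open>The term \<open>t = v\<close>, to which the induction hypothesis does not
        apply, has coefficient \<open>0\<close>, since no arc of \<open>avoiding E v\<close> starts
        at \<open>v\<close>.\<close>
      using Suc.IH by (intro sum.neutral) (auto simp: avoiding_def)
    finally show ?case .
  qed
  then have "d w = 0" using assms by (simp add: fps_eq_iff)
  then show ?thesis by (simp add: d_def h_def algebra_simps)
qed

text \<open>The excursion series \<open>h\<close> is the same for walks starting at \<open>u\<close>
  and at \<open>v\<close>. Eliminating it leaves the series of walks from \<open>u\<close> to
  \<open>w\<close> avoiding \<open>v\<close>, times the nonzero
  \<open>walk_gf V E v v\<close>.\<close>

lemma separates_iff_walk_gf:
  assumes fin: "finite V" and E: "E \<subseteq> V \<times> V" and V: "v \<in> V" "u \<in> V" "w \<in> V"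
  shows "separates E v u w \<longleftrightarrow> u \<noteq> v \<and> v \<noteq> w \<and> walk_gf V E u w \<noteq> 0 \<and>
    walk_gf V E u w * walk_gf V E v v = walk_gf V E u v * walk_gf V E v w"
proof (cases "u \<noteq> v \<and> v \<noteq> w")
  case True
  let ?P = "walk_gf V E" and ?Q = "walk_gf V (avoiding E v)"
  have av: "avoiding E v \<subseteq> V \<times> V" using E by (auto simp: avoiding_def)
  obtain h where h: "?P u w = ?Q u w + ?P u v * h" "?P v w = ?Q v w + ?P v v * h"
    using walk_gf_avoiding[OF fin V(1) V(2) V(3)] walk_gf_avoiding[OF fin V(1) V(1) V(3)] True by blast
  have "(v, w) \<notin> (avoiding E v)\<^sup>*"
    using True by (auto elim!: converse_rtranclE simp: avoiding_def)
  then have "?Q v w = 0" using walk_gf_nonzero_iff[OF fin av] by blast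
  then have "?P u w * ?P v v - ?P u v * ?P v w = ?Q u w * ?P v v"
    using h by (simp add: algebra_simps)
  moreover have "?P v v \<noteq> 0" using walk_gf_nonzero_iff[OF fin E] by blast
  ultimately have "?P u w * ?P v v = ?P u v * ?P v w \<longleftrightarrow> ?Q u w = 0"
    by (metis eq_iff_diff_eq_0 mult_eq_0_iff)
  then show ?thesis
    using True walk_gf_nonzero_iff[OF fin av] walk_gf_nonzero_iff[OF fin E]
    by (auto simp: separates_def)
qed (auto simp: separates_def)

subsection \<open>Inseparable pairs\<close>

lemma avoiding_subset: "avoiding E v \<subseteq> E"
  by (auto simp: avoiding_def)

lemma sym_avoiding: "sym E \<Longrightarrow> sym (avoiding E v)"
  by (auto simp: avoiding_def sym_def)

definition inseparable :: "'a rel \<Rightarrow> 'a \<Rightarrow> 'a \<Rightarrow> bool" where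
  "inseparable E u w \<longleftrightarrow> u \<noteq> w \<and> (u, w) \<in> E\<^sup>* \<and> (\<forall>v. \<not> separates E v u w)"

definition inseparable_clique :: "'a rel \<Rightarrow> 'a set \<Rightarrow> bool" where
  "inseparable_clique E C \<longleftrightarrow> (\<forall>x\<in>C. \<forall>y\<in>C. x \<noteq> y \<longrightarrow> inseparable E x y)"

text \<open>For symmetric \<open>E\<close> and inseparable \<open>u\<close>, \<open>w\<close> this
  is the largest inseparable clique containing both.\<close>

definition block_verts :: "'a rel \<Rightarrow> 'a \<Rightarrow> 'a \<Rightarrow> 'a set" where
  "block_verts E u w = {u, w} \<union> {x. inseparable E u x \<and> inseparable E x w}"

lemma inseparable_iff:
  "inseparable E u w \<longleftrightarrow>
    u \<noteq> w \<and> (u, w) \<in> E\<^sup>* \<and> (\<forall>v. v \<noteq> u \<longrightarrow> v \<noteq> w \<longrightarrow> (u, w) \<in> (avoiding E v)\<^sup>*)"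
  by (auto simp: inseparable_def separates_def)

lemma inseparable_sym: "sym E \<Longrightarrow> inseparable E u w \<Longrightarrow> inseparable E w u"
  unfolding inseparable_iff by (metis sym_avoiding sym_rtrancl symD)

text \<open>A single vertex \<open>z\<close> cannot equal both \<open>u\<close> and
  \<open>w\<close>, so a route through one of them avoids it.\<close>

lemma inseparable_trans:
  assumes "inseparable E x u" "inseparable E u y" "inseparable E x w" "inseparable E w y"
    and "u \<noteq> w" "x \<noteq> y"
  shows "inseparable E x y"
  unfolding inseparable_iff
proof (intro conjI allI impI)
  show "(x, y) \<in> E\<^sup>*"
    using assms(1,2) unfolding inseparable_def by (blast intro: rtrancl_trans)
  fix z assume "z \<noteq> x" "z \<noteq> y"
  then obtain t where "z \<noteq> t" "inseparable E x t" "inseparable E t y"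
    using assms by metis
  then show "(x, y) \<in> (avoiding E z)\<^sup>*"
    using \<open>z \<noteq> x\<close> \<open>z \<noteq> y\<close> rtrancl_trans[of x t "avoiding E z" y] by (simp add: inseparable_iff)
qed (fact \<open>x \<noteq> y\<close>)

text \<open>Two members other than \<open>u\<close> and \<open>w\<close> are linked through both of
  these, as \<open>inseparable_trans\<close> requires.\<close>

lemma block_verts_clique:
  assumes "sym E" "inseparable E u w"
  shows "inseparable_clique E (block_verts E u w)"
  unfolding inseparable_clique_def
proof (intro ballI impI)
  fix x y assume xy: "x \<in> block_verts E u w" "y \<in> block_verts E u w" "x \<noteq> y"
  have uw: "u \<noteq> w" using assms by (simp add: inseparable_def)
  have comm: "inseparable E a b \<longleftrightarrow> inseparable E b a" for a b
    using inseparable_sym[OF \<open>sym E\<close>] by blast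
  have x: "x = u \<or> x = w \<or> inseparable E x u \<and> inseparable E x w"
    and y: "y = u \<or> y = w \<or> inseparable E u y \<and> inseparable E w y"
    using xy comm[of u x] comm[of w y] by (auto simp: block_verts_def)
  then consider "x \<in> {u, w}" | "y \<in> {u, w}"
    | "inseparable E x u" "inseparable E x w" "inseparable E u y" "inseparable E w y" by blast
  then show "inseparable E x y"
  proof cases
    case 1 then show ?thesis using y xy assms(2) comm[of w u] by auto
  next
    case 2 then show ?thesis using x xy assms(2) comm[of w u] by auto
  next
    case 3 then show ?thesis by (intro inseparable_trans[OF _ _ _ _ uw \<open>x \<noteq> y\<close>])
  qed
qed

lemma clique_subset_block_verts:
  assumes "sym E" "inseparable_clique E C" "u \<in> C" "w \<in> C"
  shows "C \<subseteq> block_verts E u w"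
  using assms by (auto simp: inseparable_clique_def block_verts_def)

text \<open>Each of the two sets is a clique containing a pair that generates the other, so
  maximality gives both inclusions.\<close>

lemma block_verts_eq:
  assumes "sym E" "inseparable E u w" "x \<in> block_verts E u w" "y \<in> block_verts E u w" "x \<noteq> y"
  shows "block_verts E x y = block_verts E u w"
proof -
  note cl = block_verts_clique[OF \<open>sym E\<close> assms(2)]
  have "inseparable E x y" using cl assms by (auto simp: inseparable_clique_def)
  note cl' = block_verts_clique[OF \<open>sym E\<close> this]
  have sub: "block_verts E u w \<subseteq> block_verts E x y"
    using clique_subset_block_verts[OF \<open>sym E\<close> cl] assms by blast
  then have "u \<in> block_verts E x y" "w \<in> block_verts E x y" by (auto simp: block_verts_def)
  then show ?thesis using clique_subset_block_verts[OF \<open>sym E\<close> cl'] sub by blast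
qed

lemma block_verts_subset:
  assumes "E \<subseteq> V \<times> V" "inseparable E u w"
  shows "block_verts E u w \<subseteq> V"
proof -
  have "x \<in> V \<and> y \<in> V" if "(x, y) \<in> E\<^sup>*" "x \<noteq> y" for x y
    using that assms(1) by (metis mem_Sigma_iff rtranclE converse_rtranclE subset_iff)
  then have "x \<in> V \<and> y \<in> V" if "inseparable E x y" for x y
    using that by (auto simp: inseparable_def)
  then show ?thesis using assms(2) by (auto simp: block_verts_def)
qed

text \<open>The vertex \<open>x\<close> reaches any member \<open>d\<close> in two ways: through the
  arc to \<open>c\<close>, or along the ear through \<open>c'\<close> without meeting
  \<open>c\<close>. Hence no vertex separates it from \<open>d\<close>, and maximality of the clique
  absorbs it.\<close>

lemma block_verts_no_ear:
  assumes "sym E" "inseparable E u w"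
    and c: "c \<in> block_verts E u w" "c' \<in> block_verts E u w" "c \<noteq> c'"
    and x: "(c, x) \<in> E" "(x, c') \<in> (avoiding E c)\<^sup>*"
  shows "x \<in> block_verts E u w"
proof (rule ccontr)
  let ?C = "block_verts E u w"
  assume "x \<notin> ?C"
  have cl: "inseparable E a b" if "a \<in> ?C" "b \<in> ?C" "a \<noteq> b" for a b
    using block_verts_clique[OF assms(1,2)] that by (auto simp: inseparable_clique_def)
  have xc: "(x, c) \<in> E" using x \<open>sym E\<close> by (auto dest: symD)
  have "inseparable E x d" if d: "d \<in> ?C" for d
    unfolding inseparable_iff
  proof (intro conjI allI impI)
    show "x \<noteq> d" using d \<open>x \<notin> ?C\<close> by auto
    have "(c, d) \<in> E\<^sup>*" using cl[OF c(1) d] by (cases "c = d") (auto simp: inseparable_def)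
    with xc show "(x, d) \<in> E\<^sup>*" by (rule converse_rtrancl_into_rtrancl)
    fix z assume z: "z \<noteq> x" "z \<noteq> d"
    show "(x, d) \<in> (avoiding E z)\<^sup>*"
    proof (cases "z = c")
      case True
      then have "(c', d) \<in> (avoiding E z)\<^sup>*"
        using cl[OF c(2) d] c z by (cases "c' = d") (auto simp: inseparable_iff)
      then show ?thesis using x(2) True by auto
    next
      case False
      then have "(c, d) \<in> (avoiding E z)\<^sup>*"
        using cl[OF c(1) d] z by (cases "c = d") (auto simp: inseparable_iff)
      moreover have "(x, c) \<in> avoiding E z" using xc False z by (auto simp: avoiding_def)
      ultimately show ?thesis by (rule converse_rtrancl_into_rtrancl[rotated])
    qed
  qed
  then have "x \<in> ?C" using inseparable_sym[OF \<open>sym E\<close>] by (auto simp: block_verts_def)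
  then show False using \<open>x \<notin> ?C\<close> by simp
qed

text \<open>The relation \<open>R\<close> is left general to serve twice: as \<open>E\<close> for
  connectedness of a block, and as \<open>avoiding E v\<close> for connectedness after a
  deletion.\<close>

lemma reachable_inside_block_verts:
  assumes "sym E" "inseparable E u w" "R \<subseteq> E"
    and ab: "a \<in> block_verts E u w" "b \<in> block_verts E u w" "(a, b) \<in> R\<^sup>*"
  shows "(a, b) \<in> (R \<inter> block_verts E u w \<times> block_verts E u w)\<^sup>*"
proof -
  let ?C = "block_verts E u w"
  let ?S = "R \<inter> ?C \<times> ?C"
  txt \<open>A walk leaving the block at \<open>c\<close> can only re-enter it at \<open>c\<close>.\<close>
  have "\<exists>c\<in>?C. (a, c) \<in> ?S\<^sup>* \<and>
    (t = c \<or> t \<notin> ?C \<and> (\<exists>x. x \<notin> ?C \<and> (c, x) \<in> E \<and> (x, t) \<in> (avoiding E c)\<^sup>*))"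
    if "(a, t) \<in> R\<^sup>*" for t
    using that
  proof (induction rule: rtrancl_induct)
    case base then show ?case using ab by auto
  next
    case (step t t')
    then have tt': "(t, t') \<in> E" using \<open>R \<subseteq> E\<close> by blast
    from step.IH obtain c where c: "c \<in> ?C" "(a, c) \<in> ?S\<^sup>*"
      and "t = c \<or> t \<notin> ?C \<and> (\<exists>x. x \<notin> ?C \<and> (c, x) \<in> E \<and> (x, t) \<in> (avoiding E c)\<^sup>*)" by blast
    then consider "t = c" | x where "t \<notin> ?C" "x \<notin> ?C" "(c, x) \<in> E" "(x, t) \<in> (avoiding E c)\<^sup>*" by blast
    then show ?case
    proof cases
      case 1
      show ?thesis
      proof (cases "t' \<in> ?C")
        case True
        then have "(a, t') \<in> ?S\<^sup>*"
          using c 1 step.hyps(2) by (blast intro: rtrancl_into_rtrancl)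
        then show ?thesis using True by blast
      next
        case False
        then show ?thesis using c 1 tt' by blast
      qed
    next
      case 2
      show ?thesis
      proof (cases "t' = c")
        case True
        then show ?thesis using c by blast
      next
        case False
        then have *: "(x, t') \<in> (avoiding E c)\<^sup>*"
          using 2 c tt' by (auto intro!: rtrancl_into_rtrancl[of x t] simp: avoiding_def)
        \<comment> \<open>Otherwise the walk from \<open>x\<close> to \<open>t'\<close> would be an
          ear, forcing \<open>x\<close> into the block.\<close>
        then have "t' \<notin> ?C"
          using block_verts_no_ear[OF assms(1,2) c(1) _ _ 2(3)] 2(2) False by blast
        then show ?thesis using * 2 c by blast
      qed
    qed
  qed
  from this[OF ab(3)] ab show ?thesis by auto
qed

text \<open>The ordered inseparable pairs split disjointly among the blocks. A block with
  \<open>c\<close> vertices has \<open>c (c - 1)\<close> of them, each with \<open>c - 2\<close>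
  common mates and so of weight \<open>1 / ((c - 1) c)\<close>.\<close>

lemma card_block_verts_eq_sum:
  assumes E: "sym E" "E \<subseteq> V \<times> V" and "finite V"
  shows "real (card {block_verts E u w | u w. inseparable E u w}) =
    (\<Sum>u\<in>V. \<Sum>w\<in>V. if inseparable E u w
      then 1 / (real (card {x\<in>V. inseparable E u x \<and> inseparable E x w} + 1) *
                real (card {x\<in>V. inseparable E u x \<and> inseparable E x w} + 2)) else 0)"
    (is "real (card ?MC) = (\<Sum>u\<in>V. \<Sum>w\<in>V. if _ then ?g u w else 0)")
proof -
  define D where "D C = {(u, w). u \<in> C \<and> w \<in> C \<and> u \<noteq> w}" for C :: "'a set"
  define S where "S = {(u, w). inseparable E u w}"
  have in_verts: "u \<in> V \<and> w \<in> V" if "inseparable E u w" for u w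
    using block_verts_subset[OF E(2) that] by (auto simp: block_verts_def)
  have MCV: "C \<subseteq> V" if "C \<in> ?MC" for C
    using that block_verts_subset[OF E(2)] by blast
  have MCfin: "finite ?MC"
    using MCV \<open>finite V\<close> by (auto intro: finite_subset[of _ "Pow V"])
  have SD: "S = (\<Union>C\<in>?MC. D C)"
  proof (intro equalityI subsetI)
    fix p assume "p \<in> S"
    then show "p \<in> (\<Union>C\<in>?MC. D C)"
      by (cases p) (auto simp: S_def D_def block_verts_def inseparable_def)
  next
    fix p assume "p \<in> (\<Union>C\<in>?MC. D C)"
    then show "p \<in> S"
      using block_verts_clique[OF E(1)] by (cases p) (auto simp: S_def D_def inseparable_clique_def)
  qed
  have C_eq: "C = block_verts E u w" if "C \<in> ?MC" "(u, w) \<in> D C" for C u w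
    using that block_verts_eq[OF E(1)] by (auto simp: D_def)
  have g: "sum (case_prod ?g) (D C) = 1" if C: "C \<in> ?MC" for C
  proof -
    have finC: "finite C" using MCV[OF C] \<open>finite V\<close> by (rule finite_subset)
    have "?g u w = 1 / (real (card C - 1) * real (card C))" if uw: "(u, w) \<in> D C" for u w
    proof -
      have S: "inseparable E u w" using uw C SD by (auto simp: S_def)
      have "{x. inseparable E u x \<and> inseparable E x w} = {x\<in>V. inseparable E u x \<and> inseparable E x w}"
        using in_verts by blast
      moreover have "C = block_verts E u w" using C_eq[OF C uw] .
      ultimately have "C = {u, w} \<union> {x\<in>V. inseparable E u x \<and> inseparable E x w}"
        by (simp add: block_verts_def)
      moreover have "{u, w} \<inter> {x\<in>V. inseparable E u x \<and> inseparable E x w} = {}"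
        by (auto simp: inseparable_def)
      ultimately have "card C = 2 + card {x\<in>V. inseparable E u x \<and> inseparable E x w}"
        using \<open>finite V\<close> S by (auto simp: card_Un_disjoint inseparable_def)
      then show ?thesis by simp
    qed
    then have "sum (case_prod ?g) (D C) = (\<Sum>p\<in>D C. 1 / (real (card C - 1) * real (card C)))"
      by (intro sum.cong) auto
    also have "\<dots> = real (card (D C)) / (real (card C - 1) * real (card C))" by simp
    also have "card (D C) = (card C - 1) * card C"
    proof -
      have "D C = C \<times> C - (\<lambda>x. (x, x)) ` C" by (auto simp: D_def)
      then have "card (D C) = card C * card C - card C"
        using finC by (simp add: card_Diff_subset card_image inj_on_def image_subset_iff)
      then show ?thesis by (simp add: algebra_simps)
    qed
    also have "real ((card C - 1) * card C) / (real (card C - 1) * real (card C)) = 1"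
    proof -
      obtain u w where "u \<noteq> w" "{u, w} \<subseteq> C" using C by (auto simp: block_verts_def inseparable_def)
      \<comment> \<open>This keeps the denominator nonzero.\<close>
      then have "card C \<ge> 2" using card_mono[OF finC, of "{u, w}"] by auto
      then show ?thesis by simp
    qed
    finally show ?thesis .
  qed
  have "(\<Sum>u\<in>V. \<Sum>w\<in>V. if inseparable E u w then ?g u w else 0) =
      (\<Sum>p\<in>V \<times> V. if p \<in> S then case_prod ?g p else 0)"
    by (subst sum.cartesian_product, intro sum.cong) (auto simp: S_def)
  also have "\<dots> = sum (case_prod ?g) S"
  proof -
    have "V \<times> V \<inter> S = S" using in_verts by (auto simp: S_def)
    then show ?thesis
      using sum.inter_restrict[of "V \<times> V" "case_prod ?g" S] \<open>finite V\<close> by simp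
  qed
  also have "\<dots> = (\<Sum>C\<in>?MC. sum (case_prod ?g) (D C))"
    unfolding SD
  proof (rule sum.UNION_disjoint[OF MCfin])
    have "D C \<subseteq> V \<times> V" if "C \<in> ?MC" for C
      using MCV[OF that] by (auto simp: D_def)
    then show "\<forall>C\<in>?MC. finite (D C)"
      using \<open>finite V\<close> by (meson finite_SigmaI finite_subset)
    show "\<forall>C\<in>?MC. \<forall>C'\<in>?MC. C \<noteq> C' \<longrightarrow> D C \<inter> D C' = {}"
    proof (intro ballI impI, rule ccontr)
      fix C C' assume C: "C \<in> ?MC" "C' \<in> ?MC" "C \<noteq> C'" and "D C \<inter> D C' \<noteq> {}"
      then obtain u w where "(u, w) \<in> D C" "(u, w) \<in> D C'" by auto
      then show False using C_eq[OF C(1)] C_eq[OF C(2)] C(3) by blast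
    qed
  qed
  also have "\<dots> = real (card ?MC)" using g by simp
  finally show ?thesis by (rule sym)
qed

text \<open>The map \<open>\<pi>\<close> sends a class after deletion of \<open>v\<close> to the old
  class containing it. If \<open>v\<close> separates no pair, \<open>\<pi>\<close> is injective. If
  \<open>v\<close> separates \<open>u\<close> from \<open>w\<close>, the new classes other than that
  of \<open>w\<close> still reach every old class.\<close>

lemma card_classes_less_iff_separates:
  assumes "finite V" "E \<subseteq> V \<times> V" "sym E" "v \<in> V"
  shows "card ((\<lambda>a. E\<^sup>* `` {a}) ` V) < card ((\<lambda>a. (avoiding E v)\<^sup>* `` {a}) ` (V - {v})) \<longleftrightarrow>
    (\<exists>u\<in>V. \<exists>w\<in>V. separates E v u w)"
proof -
  let ?R = "\<lambda>a. E\<^sup>* `` {a}" and ?Q = "\<lambda>a. (avoiding E v)\<^sup>* `` {a}"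
  have symR: "sym (E\<^sup>*)" "sym ((avoiding E v)\<^sup>*)"
    using assms by (auto intro: sym_rtrancl sym_avoiding)
  have R: "?R a = ?R b \<longleftrightarrow> (a, b) \<in> E\<^sup>*" and Q: "?Q a = ?Q b \<longleftrightarrow> (a, b) \<in> (avoiding E v)\<^sup>*" for a b
    using symR by (blast dest: symD intro: rtrancl_trans)+
  define \<pi> where "\<pi> X = E\<^sup>* `` X" for X
  have QR: "(avoiding E v)\<^sup>* \<subseteq> E\<^sup>*" by (rule rtrancl_mono[OF avoiding_subset])
  have \<pi>: "\<pi> (?Q a) = ?R a" for a
    unfolding \<pi>_def using QR by (blast intro: rtrancl_trans)
  show ?thesis
  proof (cases "\<exists>u\<in>V. \<exists>w\<in>V. separates E v u w")
    case False
    have "inj_on \<pi> (?Q ` (V - {v}))"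
    proof (rule inj_onI, elim imageE)
      fix X Y a b assume *: "X = ?Q a" "a \<in> V - {v}" "Y = ?Q b" "b \<in> V - {v}" "\<pi> X = \<pi> Y"
      then have "(a, b) \<in> E\<^sup>*" using R \<pi> by metis
      then show "X = Y" using False * Q by (auto simp: separates_def)
    qed
    moreover have "\<pi> ` ?Q ` (V - {v}) \<subseteq> ?R ` V" using \<pi> by auto
    ultimately have "card (?Q ` (V - {v})) \<le> card (?R ` V)"
      using \<open>finite V\<close> by (intro card_inj_on_le[of \<pi>]) auto
    then show ?thesis using False by simp
  next
    case True
    then obtain u w where uw: "u \<in> V" "w \<in> V" "u \<noteq> v" "w \<noteq> v" "(u, w) \<in> E\<^sup>*" "(u, w) \<notin> (avoiding E v)\<^sup>*"
      by (auto simp: separates_def)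
    \<comment> \<open>A walk from \<open>u\<close> in a class without \<open>v\<close> would avoid
      \<open>v\<close>, contrary to the choice of \<open>w\<close>.\<close>
    have uv: "(u, v) \<in> E\<^sup>*"
    proof (rule ccontr)
      assume nr: "(u, v) \<notin> E\<^sup>*"
      have "(u, y) \<in> (avoiding E v)\<^sup>*" if "(u, y) \<in> E\<^sup>*" for y
        using that
      proof (induction rule: rtrancl_induct)
        case (step y z)
        then have "(y, z) \<in> avoiding E v"
          using nr by (auto simp: avoiding_def intro: rtrancl_into_rtrancl)
        with step.IH show ?case by (rule rtrancl_into_rtrancl)
      qed simp
      then show False using uw by blast
    qed
    have "?R ` V \<subseteq> \<pi> ` (?Q ` (V - {v}) - {?Q w})"
    proof (rule image_subsetI)
      fix a assume a: "a \<in> V"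
      \<comment> \<open>A representative of the old class of \<open>a\<close> outside the new class
        of \<open>w\<close>: both \<open>v\<close> and the vertices of that new class are replaced
        by \<open>u\<close>.\<close>
      define b where "b = (if a = v \<or> (a, w) \<in> (avoiding E v)\<^sup>* then u else a)"
      have "(w, u) \<in> E\<^sup>*" "(v, u) \<in> E\<^sup>*" using uw uv symR by (auto dest: symD)
      then have "(a, b) \<in> E\<^sup>*" using QR by (auto simp: b_def intro: rtrancl_trans[of a w])
      then have "?R a = \<pi> (?Q b)" using R \<pi> by auto
      moreover have "b \<in> V - {v}" "?Q b \<noteq> ?Q w"
        using a uw Q by (auto simp: b_def)
      ultimately show "?R a \<in> \<pi> ` (?Q ` (V - {v}) - {?Q w})" by blast
    qed
    then have "card (?R ` V) \<le> card (?Q ` (V - {v}) - {?Q w})"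
      using \<open>finite V\<close> by (intro surj_card_le) auto
    also have "\<dots> < card (?Q ` (V - {v}))"
      using uw \<open>finite V\<close> by (intro card_Diff1_less) auto
    finally show ?thesis using True by simp
  qed
qed

subsection \<open>Components and blocks\<close>

text \<open>The library defines connectedness as strong connectedness of the symmetric
  closure.\<close>

lemma connected_iff_rtrancl:
  assumes "wf_digraph K"
  shows "Digraph_Component.connected K \<longleftrightarrow> verts K \<noteq> {} \<and>
    (\<forall>u\<in>verts K. \<forall>w\<in>verts K. (u, w) \<in> (arcs_ends K \<union> (arcs_ends K)\<inverse>)\<^sup>*)"
proof -
  interpret wf_digraph K by fact
  interpret S: pair_wf_digraph "mk_symmetric K" ..
  have "arcs_ends (with_proj (mk_symmetric K)) = arcs_ends K \<union> (arcs_ends K)\<inverse>"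
    by (auto simp: parcs_mk_symmetric arcs_ends_conv)
  then show ?thesis
    by (auto simp: Digraph_Component.connected_def strongly_connected_def S.reachable_conv)
qed

lemma connected_iff_rtrancl_symmetric:
  assumes "wf_digraph K" "symmetric K"
  shows "Digraph_Component.connected K \<longleftrightarrow> verts K \<noteq> {} \<and>
    (\<forall>u\<in>verts K. \<forall>w\<in>verts K. (u, w) \<in> (arcs_ends K)\<^sup>*)"
proof -
  have "arcs_ends K \<union> (arcs_ends K)\<inverse> = arcs_ends K"
    using assms(2) by (auto simp: symmetric_def dest: symD)
  then show ?thesis using connected_iff_rtrancl[OF assms(1)] by simp
qed

lemma arcs_ends_subset_verts: "wf_digraph K \<Longrightarrow> arcs_ends K \<subseteq> verts K \<times> verts K"
  by (auto simp: arcs_ends_conv wf_digraph.wellformed)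

lemma arcs_ends_del_vert: "arcs_ends (pre_digraph.del_vert K v) = avoiding (arcs_ends K) v"
  by (auto simp: arcs_ends_conv pre_digraph.del_vert_simps avoiding_def)

lemma symmetric_del_vert: "symmetric K \<Longrightarrow> symmetric (pre_digraph.del_vert K v)"
  by (simp add: symmetric_def arcs_ends_del_vert sym_avoiding)

lemma arcs_ends_induce_subgraph: "arcs_ends (K \<restriction> C) = arcs_ends K \<inter> C \<times> C"
  by (auto simp: arcs_ends_conv)

text \<open>Arcs of \<open>K\<close> have both ends in \<open>C\<close>, so the induced subgraph
  already contains them. This settles maximality of components and blocks.\<close>

lemma induce_subgraph_eqI:
  assumes "subgraph (G \<restriction> C) K" "subgraph K G" "verts K = C"
  shows "K = G \<restriction> C"
proof (rule pre_digraph.equality)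
  show "arcs K = arcs (G \<restriction> C)"
    using assms by (auto simp: subgraph_def compatible_def dest: wf_digraph.wellformed)
qed (use assms in \<open>auto simp: subgraph_def compatible_def\<close>)

lemma subgraph_induce:
  assumes "subgraph K G" "verts K \<subseteq> C" "C \<subseteq> verts G"
  shows "subgraph K (G \<restriction> C)"
proof -
  have "wf_digraph (G \<restriction> C)"
    using assms by (auto simp: subgraph_def intro: wf_digraph.wellformed_induce_subgraph)
  then show ?thesis
    using assms by (auto simp: subgraph_def compatible_def dest: wf_digraph.wellformed)
qed

lemma components_eq_image:
  assumes wf: "wf_digraph G" and "symmetric G"
  shows "components G = (\<lambda>C. G \<restriction> C) ` (\<lambda>a. (arcs_ends G)\<^sup>* `` {a}) ` verts G"
proof -
  let ?E = "arcs_ends G"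
  have sym: "sym ?E" using assms by (simp add: symmetric_def)
  have class_verts: "?E\<^sup>* `` {a} \<subseteq> verts G" if "a \<in> verts G" for a
    using that arcs_ends_subset_verts[OF wf] by (auto elim: rtranclE)
  have sub: "subgraph (G \<restriction> C) G" if "C \<subseteq> verts G" for C
    using wf that by (rule wf_digraph.subgraph_induce_subgraphI)
  have conn: "Digraph_Component.connected (G \<restriction> ?E\<^sup>* `` {a})" if a: "a \<in> verts G" for a
  proof -
    let ?C = "?E\<^sup>* `` {a}"
    have to: "(a, y) \<in> (?E \<inter> ?C \<times> ?C)\<^sup>*" if "(a, y) \<in> ?E\<^sup>*" for y
      using that
    proof (induction rule: rtrancl_induct)
      case (step y z)
      then have "(y, z) \<in> ?E \<inter> ?C \<times> ?C" by (auto intro: rtrancl_into_rtrancl)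
      with step.IH show ?case by (rule rtrancl_into_rtrancl)
    qed simp
    have sym': "sym (?E \<inter> ?C \<times> ?C)" using sym by (auto simp: sym_def)
    have "(y, z) \<in> (?E \<inter> ?C \<times> ?C)\<^sup>*" if "(a, y) \<in> ?E\<^sup>*" "(a, z) \<in> ?E\<^sup>*" for y z
      using to[OF that(1)] to[OF that(2)] symD[OF sym_rtrancl[OF sym']] by (meson rtrancl_trans)
    moreover have "symmetric (G \<restriction> ?C)"
      using sym' by (simp add: symmetric_def arcs_ends_induce_subgraph)
    ultimately show ?thesis
      using wf_digraph.wellformed_induce_subgraph[OF wf]
      by (subst connected_iff_rtrancl_symmetric) (auto simp: arcs_ends_induce_subgraph)
  qed
  \<comment> \<open>Competitors for maximality may be asymmetric, hence the closure with the
    converse relation.\<close>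
  have in_class: "verts K \<subseteq> ?E\<^sup>* `` {a}"
    if K: "subgraph K G" "Digraph_Component.connected K" "a \<in> verts K" for K a
  proof
    fix x assume "x \<in> verts K"
    then have "(a, x) \<in> (arcs_ends K \<union> (arcs_ends K)\<inverse>)\<^sup>*"
      using K by (auto simp: connected_iff_rtrancl subgraph_def)
    moreover have "arcs_ends K \<union> (arcs_ends K)\<inverse> \<subseteq> ?E"
      using arcs_ends_mono[OF K(1)] sym by (auto dest: symD)
    ultimately show "x \<in> ?E\<^sup>* `` {a}" using rtrancl_mono by blast
  qed
  show ?thesis
  proof (intro equalityI subsetI)
    fix K assume "K \<in> components G"
    then have K: "subgraph K G" "Digraph_Component.connected K"
      and max: "\<And>K'. subgraph K K' \<Longrightarrow> subgraph K' G \<Longrightarrow> Digraph_Component.connected K' \<Longrightarrow> K' = K"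
      by (auto simp: components_def pre_digraph.max_subgraph_def)
    then obtain a where a: "a \<in> verts K"
      by (auto simp: Digraph_Component.connected_def strongly_connected_def)
    then have aG: "a \<in> verts G" using K(1) by (auto simp: subgraph_def)
    have "G \<restriction> ?E\<^sup>* `` {a} = K"
      using subgraph_induce[OF K(1) in_class[OF K a] class_verts[OF aG]]
        sub[OF class_verts[OF aG]] conn[OF aG] by (intro max)
    then show "K \<in> (\<lambda>C. G \<restriction> C) ` (\<lambda>a. ?E\<^sup>* `` {a}) ` verts G" using aG by blast
  next
    fix K assume "K \<in> (\<lambda>C. G \<restriction> C) ` (\<lambda>a. ?E\<^sup>* `` {a}) ` verts G"
    then obtain a where K: "K = G \<restriction> ?E\<^sup>* `` {a}" and a: "a \<in> verts G" by auto
    have "K' = K" if K': "subgraph K K'" "subgraph K' G" "Digraph_Component.connected K'" for K'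
    proof -
      have le: "?E\<^sup>* `` {a} \<subseteq> verts K'" using K'(1) by (auto simp: K subgraph_def)
      then have "verts K' \<subseteq> ?E\<^sup>* `` {a}" by (intro in_class[OF K'(2,3)]) auto
      then show ?thesis using le K' unfolding K by (intro induce_subgraph_eqI) auto
    qed
    then show "K \<in> components G"
      using conn[OF a] sub[OF class_verts[OF a]] K
      by (auto simp: components_def pre_digraph.max_subgraph_def)
  qed
qed

lemma inj_induce_subgraph: "inj (\<lambda>C. G \<restriction> C)"
  by (rule injI) (metis induce_subgraph_verts)

lemma card_components:
  assumes "wf_digraph G" "symmetric G"
  shows "card (components G) = card ((\<lambda>a. (arcs_ends G)\<^sup>* `` {a}) ` verts G)"
  unfolding components_eq_image[OF assms]
  by (rule card_image) (rule inj_on_subset[OF inj_induce_subgraph subset_UNIV])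

lemma cut_vertices_eq:
  assumes "Digraph.graph G" "card (verts G) \<ge> 2"
  shows "cut_vertices G = {v\<in>verts G. \<exists>u\<in>verts G. \<exists>w\<in>verts G. separates (arcs_ends G) v u w}"
proof -
  interpret Digraph.graph G by fact
  have "card (components G) < card (components (del_vert v)) \<longleftrightarrow>
      (\<exists>u\<in>verts G. \<exists>w\<in>verts G. separates (arcs_ends G) v u w)" if "v \<in> verts G" for v
    using card_classes_less_iff_separates[OF finite_verts arcs_ends_subset_verts[OF wf_digraph]
        sym_arcs[unfolded symmetric_def] that]
    by (simp add: card_components wf_digraph wf_digraph_del_vert symmetric_del_vert sym_arcs
        arcs_ends_del_vert verts_del_vert)
  then show ?thesis using assms(2) by (auto simp: cut_vertices_def)
qed

text \<open>This covers the one-vertex convention and the empty graph.\<close>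

lemma cut_vertices_small:
  assumes "finite (verts G)" "card (verts G) < 2"
  shows "cut_vertices G = verts G"
proof -
  have "card (verts G) = 1" if "v \<in> verts G" for v
    using assms that card_gt_0_iff[of "verts G"] by fastforce
  then show ?thesis by (auto simp: cut_vertices_def)
qed

lemma two_connected_iff:
  assumes "Digraph.graph K"
  shows "two_connected K \<longleftrightarrow> verts K \<noteq> {} \<and>
    (\<forall>u\<in>verts K. \<forall>w\<in>verts K. (u, w) \<in> (arcs_ends K)\<^sup>*) \<and>
    (\<forall>v\<in>verts K. verts K - {v} \<noteq> {} \<and>
      (\<forall>u\<in>verts K - {v}. \<forall>w\<in>verts K - {v}. (u, w) \<in> (avoiding (arcs_ends K) v)\<^sup>*))"
proof -
  interpret Digraph.graph K by fact
  show ?thesis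
    using assms by (auto simp: two_connected_def connected_iff_rtrancl_symmetric wf_digraph sym_arcs
        wf_digraph_del_vert symmetric_del_vert arcs_ends_del_vert verts_del_vert)
qed

text \<open>A vertex of \<open>K\<close> is avoided by 2-connectedness, and one outside
  \<open>K\<close> is avoided by every walk in \<open>K\<close>.\<close>

lemma two_connected_inseparable_clique:
  assumes "two_connected K" "subgraph K G"
  shows "inseparable_clique (arcs_ends G) (verts K)"
  unfolding inseparable_clique_def inseparable_iff
proof (intro ballI impI allI conjI)
  fix u w assume uw: "u \<in> verts K" "w \<in> verts K" "u \<noteq> w"
  have K: "Digraph.graph K" using assms by (simp add: two_connected_def)
  note tc = iffD1[OF two_connected_iff[OF K] assms(1)]
  have EK: "arcs_ends K \<subseteq> arcs_ends G" by (rule arcs_ends_mono[OF assms(2)])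
  have uwK: "(u, w) \<in> (arcs_ends K)\<^sup>*" using tc uw by blast
  then show "(u, w) \<in> (arcs_ends G)\<^sup>*" using rtrancl_mono[OF EK] by blast
  fix z assume z: "z \<noteq> u" "z \<noteq> w"
  show "(u, w) \<in> (avoiding (arcs_ends G) z)\<^sup>*"
  proof (cases "z \<in> verts K")
    case True
    then have "(u, w) \<in> (avoiding (arcs_ends K) z)\<^sup>*" using tc uw z by blast
    moreover have "avoiding (arcs_ends K) z \<subseteq> avoiding (arcs_ends G) z"
      using EK by (auto simp: avoiding_def)
    ultimately show ?thesis using rtrancl_mono by blast
  next
    case False
    have "arcs_ends K \<subseteq> verts K \<times> verts K"
      using assms(2) by (intro arcs_ends_subset_verts) (simp add: subgraph_def)
    then have "arcs_ends K \<subseteq> avoiding (arcs_ends G) z"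
      using EK False by (auto simp: avoiding_def)
    then show ?thesis using uwK rtrancl_mono by blast
  qed
qed

lemma two_connected_block_verts:
  assumes G: "Digraph.graph G" and uw: "inseparable (arcs_ends G) u w"
  shows "two_connected (G \<restriction> block_verts (arcs_ends G) u w)"
proof -
  interpret Digraph.graph G by fact
  let ?E = "arcs_ends G" and ?C = "block_verts (arcs_ends G) u w"
  have sym: "sym ?E" using sym_arcs by (simp add: symmetric_def)
  have CV: "?C \<subseteq> verts G" by (rule block_verts_subset[OF arcs_ends_subset_verts[OF wf_digraph] uw])
  have graph: "Digraph.graph (G \<restriction> ?C)"
    using digraphI_induced induced_graph_imp_symmetric[OF sym_arcs] induced_induce[OF CV]
    by (blast intro: digraph.graphI)
  have in_C: "a = b \<or> inseparable ?E a b" if "a \<in> ?C" "b \<in> ?C" for a b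
    using block_verts_clique[OF sym uw] that by (auto simp: inseparable_clique_def)
  have "(a, b) \<in> (?E \<inter> ?C \<times> ?C)\<^sup>*" if "a \<in> ?C" "b \<in> ?C" for a b
    using reachable_inside_block_verts[OF sym uw subset_refl that] in_C[OF that]
    by (auto simp: inseparable_iff)
  moreover have "(a, b) \<in> (avoiding (?E \<inter> ?C \<times> ?C) v)\<^sup>*"
    if "a \<in> ?C - {v}" "b \<in> ?C - {v}" for a b v
  proof -
    have "(a, b) \<in> (avoiding ?E v)\<^sup>*" using in_C[of a b] that by (auto simp: inseparable_iff)
    then have "(a, b) \<in> (avoiding ?E v \<inter> ?C \<times> ?C)\<^sup>*"
      using reachable_inside_block_verts[OF sym uw avoiding_subset] that by auto
    moreover have "avoiding ?E v \<inter> ?C \<times> ?C = avoiding (?E \<inter> ?C \<times> ?C) v"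
      by (auto simp: avoiding_def)
    ultimately show ?thesis by simp
  qed
  moreover have "u \<noteq> w" "u \<in> ?C" "w \<in> ?C" using uw by (auto simp: block_verts_def inseparable_def)
  then have "?C \<noteq> {}" "?C - {v} \<noteq> {}" for v by auto
  ultimately show ?thesis
    by (simp add: two_connected_iff[OF graph] arcs_ends_induce_subgraph)
qed

text \<open>A 2-connected subgraph spans an inseparable clique, so it lies in the subgraph induced
  on \<open>block_verts\<close> of any two of its vertices, which is itself 2-connected.\<close>

lemma blocks_eq_image:
  assumes G: "Digraph.graph G"
  shows "blocks G = (\<lambda>C. G \<restriction> C) ` {block_verts (arcs_ends G) u w | u w. inseparable (arcs_ends G) u w}"
proof -
  interpret Digraph.graph G by fact
  let ?E = "arcs_ends G"
  have sym: "sym ?E" using sym_arcs by (simp add: symmetric_def)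
  have CV: "block_verts ?E u w \<subseteq> verts G" if "inseparable ?E u w" for u w
    by (rule block_verts_subset[OF arcs_ends_subset_verts[OF wf_digraph] that])
  show ?thesis
  proof (intro equalityI subsetI)
    fix B assume "B \<in> blocks G"
    then have B: "subgraph B G" "two_connected B"
      and max: "\<And>K. subgraph B K \<Longrightarrow> subgraph K G \<Longrightarrow> two_connected K \<Longrightarrow> K = B"
      by (auto simp: blocks_def max_subgraph_def)
    have "Digraph.graph B" using B(2) by (simp add: two_connected_def)
    then obtain u w where "u \<in> verts B" "w \<in> verts B - {u}"
      using B(2) two_connected_iff by blast
    then have uw: "u \<in> verts B" "w \<in> verts B" "u \<noteq> w" by auto
    note cl = two_connected_inseparable_clique[OF B(2,1)]
    have uwE: "inseparable ?E u w" using cl uw by (simp add: inseparable_clique_def)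
    have "G \<restriction> block_verts ?E u w = B"
      using subgraph_induce[OF B(1) clique_subset_block_verts[OF sym cl uw(1,2)] CV[OF uwE]]
        subgraph_induce_subgraphI[OF CV[OF uwE]] two_connected_block_verts[OF G uwE]
      by (intro max)
    then show "B \<in> (\<lambda>C. G \<restriction> C) ` {block_verts ?E u w | u w. inseparable ?E u w}"
      using uwE by blast
  next
    fix B assume "B \<in> (\<lambda>C. G \<restriction> C) ` {block_verts ?E u w | u w. inseparable ?E u w}"
    then obtain u w where uw: "inseparable ?E u w" and B: "B = G \<restriction> block_verts ?E u w" by auto
    have "K = B" if K: "subgraph B K" "subgraph K G" "two_connected K" for K
    proof -
      have le: "block_verts ?E u w \<subseteq> verts K" using K(1) by (auto simp: B subgraph_def)
      then have "verts K \<subseteq> block_verts ?E u w"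
        using two_connected_inseparable_clique[OF K(3,2)]
        by (intro clique_subset_block_verts[OF sym]) (auto simp: block_verts_def)
      then show ?thesis using le K unfolding B by (intro induce_subgraph_eqI) auto
    qed
    then show "B \<in> blocks G"
      using two_connected_block_verts[OF G uw] subgraph_induce_subgraphI[OF CV[OF uw]] B
      by (auto simp: blocks_def max_subgraph_def)
  qed
qed

lemma card_blocks:
  assumes "Digraph.graph G"
  shows "card (blocks G) = card {block_verts (arcs_ends G) u w | u w. inseparable (arcs_ends G) u w}"
  unfolding blocks_eq_image[OF assms]
  by (rule card_image) (rule inj_on_subset[OF inj_induce_subgraph subset_UNIV])

subsection \<open>Transfer along a quantum isomorphism\<close>

context orthogonal_magic_unitary
begin

context
  fixes E :: "'a rel" and F :: "'b rel"
  assumes adj: "\<And>i k j l. tied i k j l \<Longrightarrow> (k, l) \<in> E \<longleftrightarrow> (i, j) \<in> F"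
    and E: "E \<subseteq> V \<times> V" and F: "F \<subseteq> W \<times> W"
begin

text \<open>The recursion sums over a penultimate vertex, which \<open>sum_eq_if_tied\<close> ties
  to both ends.\<close>

lemma walks_eq_if_tied: "tied i k j l \<Longrightarrow> walks V E n k l = walks W F n i j"
proof (induction n arbitrary: j l)
  case 0 then show ?case using tiedD(8)[OF 0] by simp
next
  case (Suc n)
  show ?case
    unfolding walks.simps
    by (rule sum_eq_if_tied[OF Suc.prems]) (use Suc.IH adj in auto)
qed

lemma walk_gf_eq_if_tied: "tied i k j l \<Longrightarrow> walk_gf V E k l = walk_gf W F i j"
  by (simp add: walk_gf_def walks_eq_if_tied)

text \<open>All four series in \<open>separates_iff_walk_gf\<close> transfer; the one of closed
  walks at \<open>m\<close> does so because \<open>(p, m)\<close> is tied to itself.\<close>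

lemma separates_eq_if_tied:
  assumes "tied i k j l" "tied i k p m" "tied p m j l"
  shows "separates E m k l \<longleftrightarrow> separates F p i j"
  using tiedD[OF assms(1)] tiedD[OF assms(2)] tiedD[OF assms(3)] assms
    walk_gf_eq_if_tied[OF assms(1)] walk_gf_eq_if_tied[OF assms(2)] walk_gf_eq_if_tied[OF assms(3)]
    walk_gf_eq_if_tied[OF tiedD(7)[OF assms(2)]]
  by (simp add: separates_iff_walk_gf[OF finite_V E] separates_iff_walk_gf[OF finite_W F])

lemma inseparable_eq_if_tied:
  assumes t: "tied i k j l"
  shows "inseparable E k l \<longleftrightarrow> inseparable F i j"
proof -
  have "(\<exists>m\<in>V. separates E m k l) \<longleftrightarrow> (\<exists>p\<in>W. separates F p i j)"
    by (rule ex_iff_if_tied[OF t]) (rule separates_eq_if_tied[OF t])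
  \<comment> \<open>Deleting a vertex outside \<open>V\<close> removes no arc, so the quantifier
    over all vertices in \<open>inseparable\<close> may be restricted to \<open>V\<close>.\<close>
  moreover have "separates E m k l \<Longrightarrow> m \<in> V" for m k l
  proof (rule ccontr)
    assume "separates E m k l" "m \<notin> V"
    moreover have "avoiding E m = E" using E \<open>m \<notin> V\<close> by (auto simp: avoiding_def)
    ultimately show False by (simp add: separates_def)
  qed
  moreover have "separates F p i j \<Longrightarrow> p \<in> W" for p i j
  proof (rule ccontr)
    assume "separates F p i j" "p \<notin> W"
    moreover have "avoiding F p = F" using F \<open>p \<notin> W\<close> by (auto simp: avoiding_def)
    ultimately show False by (simp add: separates_def)
  qed
  moreover have "(k, l) \<in> E\<^sup>* \<longleftrightarrow> (i, j) \<in> F\<^sup>*"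
    using walk_gf_eq_if_tied[OF t] walk_gf_nonzero_iff[OF finite_V E]
      walk_gf_nonzero_iff[OF finite_W F] by metis
  ultimately show ?thesis
    using tiedD(8)[OF t] unfolding inseparable_def by metis
qed

lemma card_block_verts_eq:
  assumes "sym E" "sym F"
  shows "card {block_verts E u w | u w. inseparable E u w} =
    card {block_verts F u w | u w. inseparable F u w}"
proof -
  have mates: "card {m\<in>V. inseparable E k m \<and> inseparable E m l} =
      card {p\<in>W. inseparable F i p \<and> inseparable F p j}" if "tied i k j l" for i k j l
  proof -
    have "(\<Sum>m\<in>V. of_bool (inseparable E k m \<and> inseparable E m l)) =
        (\<Sum>p\<in>W. of_bool (inseparable F i p \<and> inseparable F p j) :: real)"
      by (rule sum_eq_if_tied[OF that]) (simp add: inseparable_eq_if_tied)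
    then show ?thesis using finite_V finite_W by (simp add: Int_def)
  qed
  have "real (card {block_verts E u w | u w. inseparable E u w}) =
      real (card {block_verts F u w | u w. inseparable F u w})"
    unfolding card_block_verts_eq_sum[OF assms(1) E finite_V] card_block_verts_eq_sum[OF assms(2) F finite_W]
    by (rule double_sum_eq) (simp add: mates inseparable_eq_if_tied)
  then show ?thesis by simp
qed

lemma card_separating_eq:
  "card {v\<in>V. \<exists>u\<in>V. \<exists>w\<in>V. separates E v u w} = card {v\<in>W. \<exists>u\<in>W. \<exists>w\<in>W. separates F v u w}"
proof (rule card_eq)
  have "(\<exists>w\<in>V. separates E k l w) \<longleftrightarrow> (\<exists>w\<in>W. separates F i j w)" if t: "tied i k j l" for i k j l
    \<comment> \<open>Here \<open>k\<close> is the separating vertex and \<open>l\<close> an end, so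
      the ties are used in reversed order.\<close>
    by (rule ex_iff_if_tied[OF t]) (meson separates_eq_if_tied tiedD(5) t)
  then show "(\<exists>u\<in>V. \<exists>w\<in>V. separates E k u w) \<longleftrightarrow> (\<exists>u\<in>W. \<exists>w\<in>W. separates F i u w)"
    if "tied i k i k" for i k
    by (rule ex_iff_if_tied[OF that])
qed

end

end

theorem corollary5p6:
  fixes G :: "('a, 'e) pre_digraph" and H :: "('b, 'f) pre_digraph"
  assumes "Digraph.graph G" and "Digraph.graph H"
    and "quantum_isomorphic TYPE('x::unital_cstar_algebra) G H"
  shows "card (blocks G) = card (blocks H) \<and> card (cut_vertices G) = card (cut_vertices H)"
proof -
  interpret G: Digraph.graph G by fact
  interpret H: Digraph.graph H by fact
  obtain U :: "'b \<Rightarrow> 'a \<Rightarrow> 'x" where U: "quantum_isomorphism U G H"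
    using assms(3) by (auto simp: quantum_isomorphic_def)
  interpret U: orthogonal_magic_unitary U "verts H" "verts G"
    by (rule quantum_isomorphism_orthogonal[OF U])
  note sub = arcs_ends_subset_verts[OF G.wf_digraph] arcs_ends_subset_verts[OF H.wf_digraph]
  note adj = quantum_isomorphism_adjacency[OF U]
  have card: "card (verts G) = card (verts H)" using U by (simp add: quantum_isomorphism_def)
  have "card (blocks G) = card (blocks H)"
    using U.card_block_verts_eq[OF adj sub] G.sym_arcs H.sym_arcs
    by (simp add: card_blocks assms symmetric_def)
  moreover have "card (cut_vertices G) = card (cut_vertices H)"
  proof (cases "card (verts G) \<ge> 2")
    case True
    then show ?thesis
      using U.card_separating_eq[OF adj sub] card by (simp add: cut_vertices_eq assms)
  next
    case False
    then show ?thesis using card by (simp add: cut_vertices_small)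
  qed
  ultimately show ?thesis by blast
qed

end
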